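(* Let $d\ge 3$ and let $Q$ be a probability measure on $\Omega=\{0,1\}^{\mathbb{Z}^d}$ satisfying the standing assumptions (i) and (ii) of the context. Then the random walk $\{X_n\}_{n\ge 0}$ on the discrete point process is $\mathbb{P}$-almost surely transient, i.e. for $P$-almost every $\omega\in\Omega_0$, $P_\omega(X_n=0\text{ for infinitely many }n)=0$.
   Context: Setting. $\Omega=\{0,1\}^{\mathbb{Z}^d}$ with its Borel (product) $\sigma$-algebra $\mathfrak{B}$; for $x\in\mathbb{Z}^d$ the shift $\theta_x:\Omega\to\Omega$ is $(\theta_x\omega)(y)=\omega(x+y)$; $e_1,\dots,e_d$ are the standard basis vectors and $\mathcal{E}=\{\pm e_i\}_{i=1}^d$; $\mathcal{P}(\omega)=\{x\in\mathbb{Z}^d:\omega(x)=1\}$. Standing assumptions on $Q$: (i) $Q$ is stationary (invariant) and ergodic with respect to each single shift $\theta_{e_i}$, $i=1,\dots,d$; (ii) $Q(\mathcal{P}(\omega)=\emptyset)<1$. $\Omega_0=\{\omega\in\Omega:\omega(0)=1\}$ (it has positive $Q$-measure), and $P=Q(\cdot\mid\Omega_0)$. For $e\in\mathcal{E}$, $f_e(\omega)=\min\{k>0:\omega(ke)=1\}$ (almost surely finite). For $v\in\mathbb{Z}^d$, $N_v(\omega)=\{v+f_e(\theta_v\omega)e: e\in\mathcal{E}\}$ is the set of the $2d$ coordinate nearest neighbors of $v$, one in each of the $2d$ directions. Random walk. For $P$-a.e. $\omega\in\Omega_0$, the quenched law $P_\omega$ on $(\mathbb{Z}^d)^{\mathbb{N}}$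 is the law of the Markov chain $\{X_n\}_{n\ge0}$ on $\mathcal{P}(\omega)$ with $X_0=0$ and $P_\omega(X_{n+1}=u\mid X_n=v)=\frac1{2d}$ if $u\in N_v(\omega)$ and $0$ otherwise. The annealed law is $\mathbb{P}(\cdot)=\int_{\Omega_0}P_\omega(\cdot)\,P(d\omega)$. *)

theory Defs
  imports "HOL-Probability.Probability"
begin

text \<open>\<open>\<int>\<^sup>d\<close> is the type \<open>int ^ 'd\<close> with \<open>d = CARD('d)\<close>. A configuration \<open>\<omega>\<close> is a
  boolean function, \<open>\<omega> x\<close> standing for \<open>\<omega>(x) = 1\<close>; since \<open>\<int>\<^sup>d\<close> is countable, the product
  \<open>\<sigma>\<close>-algebra below is the Borel \<open>\<sigma>\<close>-algebra of the product topology.\<close>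

type_synonym 'd config = "int ^ 'd \<Rightarrow> bool"

definition config_space :: "('d::finite) config measure" where
  "config_space = PiM UNIV (\<lambda>_. count_space UNIV)"

definition shift_by :: "int ^ 'd \<Rightarrow> ('d::finite) config \<Rightarrow> 'd config" where
  "shift_by x \<omega> = (\<lambda>y. \<omega> (x + y))"

definition points :: "('d::finite) config \<Rightarrow> (int ^ 'd) set" where
  "points \<omega> = {x. \<omega> x}"

definition units :: "(int ^ ('d::finite)) set" where
  "units = range (\<lambda>i. axis i 1) \<union> range (\<lambda>i. - axis i 1)"

definition invariant_under :: "'a measure \<Rightarrow> ('a \<Rightarrow> 'a) \<Rightarrow> bool" where
  "invariant_under M T \<longleftrightarrow> T \<in> measurable M M \<and> distr M M T = M"

definition ergodic_under :: "'a measure \<Rightarrow> ('a \<Rightarrow> 'a) \<Rightarrow> bool" where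
  "ergodic_under M T \<longleftrightarrow> invariant_under M T \<and>
     (\<forall>A\<in>sets M. T -` A \<inter> space M = A \<longrightarrow> emeasure M A = 0 \<or> emeasure M A = 1)"

definition occupied_origin :: "('d::finite) config set" where
  "occupied_origin = {\<omega>. \<omega> 0}"

definition conditioned :: "('d::finite) config measure \<Rightarrow> 'd config measure" where
  "conditioned Q = uniform_measure Q occupied_origin"

text \<open>The value is unspecified if the ray from the origin in direction \<open>e\<close> meets no point.\<close>

definition first_hit :: "int ^ 'd \<Rightarrow> ('d::finite) config \<Rightarrow> nat" where
  "first_hit e \<omega> = (LEAST k. 0 < k \<and> \<omega> (int k *s e))"

definition neighbors :: "int ^ 'd \<Rightarrow> ('d::finite) config \<Rightarrow> (int ^ 'd) set" where
  "neighbors v \<omega> = (\<lambda>e. v + int (first_hit e (shift_by v \<omega>)) *s e) ` units"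

text \<open>One step of the walk. \<open>pmf_step\<close> below shows that the weights are \<open>1 / (2 d)\<close> on
  \<open>neighbors v \<omega>\<close> whenever all \<open>2 d\<close> neighbors of \<open>v\<close> exist.\<close>

definition step :: "('d::finite) config \<Rightarrow> int ^ 'd \<Rightarrow> (int ^ 'd) pmf" where
  "step \<omega> v = pmf_of_set (neighbors v \<omega>)"

definition path_space :: "(nat \<Rightarrow> int ^ ('d::finite)) measure" where
  "path_space = PiM UNIV (\<lambda>_. count_space UNIV)"

fun walk_kernel :: "('d::finite) config \<Rightarrow> nat \<Rightarrow> (nat \<Rightarrow> int ^ 'd) \<Rightarrow> (int ^ 'd) measure" where
  "walk_kernel \<omega> 0 X = return (count_space UNIV) 0"
| "walk_kernel \<omega> (Suc n) X = measure_pmf (step \<omega> (X n))"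

text \<open>The quenched law is the Ionescu-Tulcea measure of these kernels; its cylinder
  probabilities are computed in \<open>emeasure_quenched_law_cylinder\<close> below.\<close>

definition quenched_law :: "('d::finite) config \<Rightarrow> (nat \<Rightarrow> int ^ 'd) measure" where
  "quenched_law \<omega> = projective_family.lim UNIV
     (Ionescu_Tulcea.CI (walk_kernel \<omega>) (\<lambda>_. count_space UNIV)) (\<lambda>_. count_space UNIV)"

definition annealed_law :: "('d::finite) config measure \<Rightarrow> (nat \<Rightarrow> int ^ 'd) measure" where
  "annealed_law Q = conditioned Q \<bind> quenched_law"

definition returns_infinitely_often :: "(nat \<Rightarrow> int ^ ('d::finite)) set" where
  "returns_infinitely_often = {X. infinite {n. X n = 0}}"

lemma space_config_space [simp]: "space config_space = UNIV"
  by (simp add: config_space_def space_PiM)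

lemma space_path_space [simp]: "space path_space = UNIV"
  by (simp add: path_space_def space_PiM)

lemma units_eq: "units = (\<lambda>(s, i). s *s axis i 1) ` ({1, -1} \<times> UNIV)"
  by (auto simp: units_def image_iff vec_eq_iff axis_def intro: exI)

lemma finite_units [simp]: "finite (units :: (int ^ 'd::finite) set)"
  by (simp add: units_def)

lemma units_nonempty [simp]: "units \<noteq> {}"
  by (simp add: units_def)

lemma axis_one_eq_iff: "axis i (1::int) = axis j 1 \<longleftrightarrow> i = j"
  by (auto simp: axis_eq_axis)

lemma axis_ne_minus: "axis i (1::int) \<noteq> - axis j 1"
proof
  assume *: "axis i (1::int) = - axis j 1"
  have "axis i (1::int) $ i = (- axis j (1::int)) $ i" using * by simp
  then show False by (auto simp: axis_def split: if_splits)
qed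

lemma card_units: "card (units :: (int ^ 'd::finite) set) = 2 * CARD('d)"
proof -
  have "range (\<lambda>i. axis i (1::int)) \<inter> range (\<lambda>i::'d. - axis i 1) = {}"
    using axis_ne_minus by auto
  moreover have "inj (\<lambda>i::'d. axis i (1::int))" "inj (\<lambda>i::'d. - axis i (1::int))"
    by (auto simp: inj_on_def axis_one_eq_iff)
  ultimately show ?thesis
    unfolding units_def by (subst card_Un_disjoint) (auto simp: card_image)
qed

lemma finite_neighbors [simp]: "finite (neighbors v \<omega>)"
  by (simp add: neighbors_def)

lemma neighbors_nonempty [simp]: "neighbors v \<omega> \<noteq> {}"
  by (simp add: neighbors_def)

lemma units_multiple_eq:
  assumes e: "e \<in> units" "e' \<in> units" and k: "0 < k" "0 < k'"
    and eq: "int k *s e = int k' *s (e' :: int ^ 'd::finite)"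
  shows "e = e'"
proof -
  obtain s i where s: "e = s *s axis i 1" "s \<in> {1,-1}" using e(1) by (auto simp: units_eq)
  obtain t j where t: "e' = t *s axis j 1" "t \<in> {1,-1}" using e(2) by (auto simp: units_eq)
  have "(int k *s e) $ i = (int k' *s e') $ i" "(int k *s e) $ j = (int k' *s e') $ j"
    using eq by auto
  then show ?thesis using s t k by (auto simp: axis_def split: if_splits)
qed

lemma card_neighbors:
  assumes "\<And>e. e \<in> units \<Longrightarrow> \<exists>k>0. \<omega> (v + int k *s e)"
  shows "card (neighbors v (\<omega> :: 'd::finite config)) = 2 * CARD('d)"
proof -
  have pos: "0 < first_hit e (shift_by v \<omega>)" if "e \<in> units" for e
    using LeastI_ex[of "\<lambda>k. 0 < k \<and> shift_by v \<omega> (int k *s e)"] assms[OF that]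
    by (auto simp: first_hit_def shift_by_def)
  have "inj_on (\<lambda>e. v + int (first_hit e (shift_by v \<omega>)) *s e) units"
    by (intro inj_onI) (auto intro: units_multiple_eq pos)
  then show ?thesis by (simp add: neighbors_def card_image card_units)
qed

lemma pmf_step:
  assumes "\<And>e. e \<in> units \<Longrightarrow> \<exists>k>0. \<omega> (v + int k *s e)"
  shows "pmf (step (\<omega> :: 'd::finite config) v) u =
    (if u \<in> neighbors v \<omega> then 1 / (2 * real CARD('d)) else 0)"
  by (simp add: step_def card_neighbors[OF assms] indicator_def)

lemma Ionescu_Tulcea_walk_kernel: "Ionescu_Tulcea (walk_kernel \<omega>) (\<lambda>_. count_space UNIV)"
proof (rule Ionescu_Tulcea.intro)
  fix i
  show "walk_kernel \<omega> i \<in> measurable (PiM {0..<i} (\<lambda>_. count_space UNIV))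
      (subprob_algebra (count_space UNIV))"
  proof (cases i)
    case 0
    have *: "walk_kernel \<omega> 0 = (\<lambda>X. return (count_space UNIV) 0)" by (rule ext) simp
    show ?thesis unfolding 0 *
      by (intro measurable_const)
         (simp add: space_subprob_algebra prob_space_imp_subprob_space prob_space_return)
  next
    case (Suc n)
    have *: "walk_kernel \<omega> (Suc n) = (\<lambda>X. measure_pmf (step \<omega> (X n)))" by (rule ext) simp
    have "(\<lambda>X. X n) \<in> measurable (PiM {0..<i} (\<lambda>_. count_space UNIV)) (count_space (UNIV :: (int^'d) set))"
      using Suc by (intro measurable_component_singleton) auto
    then show ?thesis unfolding Suc *
      by (rule measurable_compose) (simp add: measure_pmf_in_subprob_algebra)
  qed
next
  fix i x
  show "prob_space (walk_kernel \<omega> i x)"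
    by (cases i) (simp_all add: prob_space_return prob_space_measure_pmf)
qed

interpretation walk: Ionescu_Tulcea "walk_kernel \<omega>" "\<lambda>_. count_space UNIV"
  for \<omega> :: "'d::finite config"
  by (rule Ionescu_Tulcea_walk_kernel)

lemma prob_space_quenched_law: "prob_space (quenched_law \<omega>)"
proof (rule prob_spaceI)
  have "space (quenched_law \<omega>) = prod_emb UNIV (\<lambda>_. count_space UNIV) {} {\<lambda>_. undefined}"
    by (auto simp: quenched_law_def prod_emb_def space_PiM)
  then have "emeasure (quenched_law \<omega>) (space (quenched_law \<omega>)) = emeasure (walk.CI \<omega> {}) {\<lambda>_. undefined}"
    unfolding quenched_law_def using walk.lim[of "{}" "{\<lambda>_. undefined}" \<omega>] by (simp add: sets_PiM_empty)
  also have "\<dots> = 1"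
    using prob_space.emeasure_space_1[OF walk.PF.prob_space_P[of "{}" \<omega>]]
    by (simp add: walk.PF.space_P space_PiM_empty)
  finally show "emeasure (quenched_law \<omega>) (space (quenched_law \<omega>)) = 1" .
qed

lemma sets_quenched_law [simp, measurable_cong]: "sets (quenched_law \<omega>) = sets path_space"
  unfolding quenched_law_def path_space_def by simp

lemma emeasure_quenched_law_cylinder:
  fixes x :: "nat \<Rightarrow> int ^ 'd::finite"
  shows "emeasure (quenched_law \<omega>) {X. \<forall>i\<le>n. X i = x i} =
    (if x 0 = 0 then \<Prod>i<n. ennreal (pmf (step \<omega> (x i)) (x (Suc i))) else 0)"
proof -
  let ?M = "\<lambda>_::nat. count_space (UNIV :: (int ^ 'd) set)"
  let ?x = "\<lambda>n. restrict x {0..<n}"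
  let ?C = "\<lambda>n. walk.C \<omega> 0 n (\<lambda>_. undefined)"
  have sing: "{?x n} \<in> sets (PiM {0..<n} ?M)" for n
  proof -
    have "{?x n} = PiE {0..<n} (\<lambda>i. {x i})"
      by (auto simp: PiE_iff extensional_def fun_eq_iff restrict_def)
    then show ?thesis by simp
  qed
  have C: "emeasure (?C (Suc n)) {?x (Suc n)} = emeasure (?C n) {?x n} * emeasure (walk_kernel \<omega> n x) {x n}"
    for n
  proof -
    have k: "walk_kernel \<omega> n (?x n) = walk_kernel \<omega> n x" by (cases n) auto
    have "emeasure (?C (Suc n)) {?x (Suc n)} = (\<integral>\<^sup>+ y. emeasure (walk.eP \<omega> n y) {?x (Suc n)} \<partial>?C n)"
      using sing[of "Suc n"] walk.measurable_eP[of \<omega> n]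
      by (simp, subst emeasure_bind[where N = "PiM {0..<Suc n} ?M"])
         (auto simp: walk.space_C measurable_cong_sets[OF walk.sets_C])
    also have "\<dots> = (\<integral>\<^sup>+ y. emeasure (walk_kernel \<omega> n x) {x n} * indicator {?x n} y \<partial>?C n)"
    proof (intro nn_integral_cong)
      fix y assume "y \<in> space (?C n)"
      then have y: "y \<in> space (PiM {0..<n} ?M)" by (simp add: walk.space_C)
      then have y': "y \<in> extensional {0..<n}" by (simp add: space_PiM PiE_iff)
      have "(\<lambda>z. y(n := z)) -` {?x (Suc n)} = (if y = ?x n then {x n} else {})"
      proof -
        have "y(n := z) = ?x (Suc n) \<longleftrightarrow> y = ?x n \<and> z = x n" for z
        proof
          assume a: "y(n := z) = ?x (Suc n)"
          have "y i = ?x n i" for i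
            using fun_cong[OF a, of i] y' by (cases "i < n") (auto simp: extensional_def restrict_def split: if_splits)
          moreover have "z = x n" using fun_cong[OF a, of n] by simp
          ultimately show "y = ?x n \<and> z = x n" by auto
        qed (auto simp: fun_eq_iff restrict_def)
        then show ?thesis unfolding vimage_singleton_eq set_eq_iff vimage_def by simp
      qed
      note v = this
      have e: "emeasure (walk.eP \<omega> n y) {?x (Suc n)} =
          emeasure (walk_kernel \<omega> n y) ((\<lambda>z. y(n := z)) -` {?x (Suc n)})"
        using walk.emeasure_eP[OF y sing[of "Suc n"], of \<omega>] by simp
      show "emeasure (walk.eP \<omega> n y) {?x (Suc n)} = emeasure (walk_kernel \<omega> n x) {x n} * indicator {?x n} y"
      proof (cases "y = ?x n")
        case True
        then show ?thesis unfolding e v unfolding True by (simp only: if_True k refl) simp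
      next
        case False
        then show ?thesis unfolding e v by simp
      qed
    qed
    also have "\<dots> = emeasure (?C n) {?x n} * emeasure (walk_kernel \<omega> n x) {x n}"
      using sing[of n] by (subst nn_integral_cmult_indicator) (auto simp: walk.sets_C mult.commute)
    finally show ?thesis .
  qed
  have C': "emeasure (?C (Suc n)) {?x (Suc n)} =
    (if x 0 = 0 then \<Prod>i<n. ennreal (pmf (step \<omega> (x i)) (x (Suc i))) else 0)" for n
  proof (induction n)
    case 0
    have "?x 0 = (\<lambda>_. undefined)" by auto
    then have "emeasure (?C 0) {?x 0} = 1"
      using sing[of 0] by (simp add: emeasure_return)
    then show ?case unfolding C[of 0] by (simp add: indicator_def)
  next
    case (Suc n)
    show ?case unfolding C[of "Suc n"] Suc by (simp add: emeasure_pmf_single)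
  qed
  have "{X. \<forall>i\<le>n. X i = x i} = prod_emb UNIV ?M {0..<Suc n} {?x (Suc n)}"
    by (auto simp: prod_emb_def space_PiM fun_eq_iff restrict_def less_Suc_eq_le) metis
  then have "emeasure (quenched_law \<omega>) {X. \<forall>i\<le>n. X i = x i} = emeasure (walk.CI \<omega> {0..<Suc n}) {?x (Suc n)}"
    unfolding quenched_law_def by (simp only: walk.lim[OF _ sing] finite_atLeastLessThan)
  also have "\<dots> = emeasure (?C (Suc n)) {?x (Suc n)}"
    using walk.emeasure_CI[OF order_refl sing[of "Suc n"]] sets.sets_into_space[OF sing[of "Suc n"]]
    by (simp add: prod_emb_id space_PiM)
  finally show ?thesis using C' by simp
qed

lemma measurable_site [measurable]: "(\<lambda>\<omega>. \<omega> z) \<in> measurable config_space (count_space UNIV)"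
  unfolding config_space_def by (rule measurable_component_singleton) simp

lemma measurable_first_hit [measurable]:
  "(\<lambda>\<omega>. first_hit e (shift_by v \<omega>)) \<in> measurable config_space (count_space UNIV)"
  unfolding first_hit_def shift_by_def by measurable

lemma measurable_neighbors:
  fixes v :: "int ^ ('d::finite)"
  shows "neighbors v \<in> measurable config_space (count_space (Collect finite))"
proof -
  have "neighbors v -` {S} \<inter> space config_space \<in> sets config_space" if "finite S" for S
  proof -
    have "neighbors v -` {S} \<inter> space config_space = {\<omega> \<in> space config_space.
        (\<forall>e\<in>units. first_hit e (shift_by v \<omega>) \<in> {k. v + int k *s e \<in> S}) \<and>
        (\<forall>s\<in>S. \<exists>e\<in>units. first_hit e (shift_by v \<omega>) \<in> {k. v + int k *s e = s})}"
    proof -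
      have "neighbors v \<omega> = S \<longleftrightarrow>
          (\<forall>e\<in>units. v + int (first_hit e (shift_by v \<omega>)) *s e \<in> S) \<and>
          (\<forall>s\<in>S. \<exists>e\<in>units. v + int (first_hit e (shift_by v \<omega>)) *s e = s)" for \<omega>
      proof -
        have "f ` U = S \<longleftrightarrow> (\<forall>e\<in>U. f e \<in> S) \<and> (\<forall>s\<in>S. \<exists>e\<in>U. f e = s)"
          for f :: "int ^ 'd \<Rightarrow> int ^ 'd" and U by fast
        then show ?thesis unfolding neighbors_def .
      qed
      then show ?thesis by (simp add: vimage_def)
    qed
    also have "\<dots> \<in> sets config_space"
    proof -
      have hit: "{\<omega> \<in> space config_space. first_hit e (shift_by v \<omega>) \<in> K} \<in> sets config_space"
        for e :: "int ^ 'd" and K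
        using measurable_sets[OF measurable_first_hit[of e v], of K]
        by (simp add: vimage_def Int_def conj_commute)
      show ?thesis
        by (intro sets.sets_Collect_conj sets.sets_Collect_finite_All sets.sets_Collect_finite_Ex
            hit finite_units that)
    qed
    finally show ?thesis .
  qed
  then show ?thesis
    by (subst measurable_count_space_eq_countable) (auto intro: countable_Collect_finite)
qed

lemma measurable_pmf_step [measurable]:
  "(\<lambda>\<omega>. pmf (step \<omega> v) u) \<in> borel_measurable config_space"
proof -
  have "(\<lambda>\<omega>. indicator (neighbors v \<omega>) u / real (card (neighbors v \<omega>))) \<in> borel_measurable config_space"
    by (rule measurable_compose[OF measurable_neighbors]) simp
  then show ?thesis by (simp add: step_def)
qed

lemma measurable_coordinate [measurable]: "(\<lambda>X. X n) \<in> measurable path_space (count_space UNIV)"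
  unfolding path_space_def by (rule measurable_component_singleton) simp

lemma returns_infinitely_often_in_sets [measurable]: "returns_infinitely_often \<in> sets path_space"
proof -
  have "returns_infinitely_often = {X \<in> space path_space. \<forall>m. \<exists>n\<ge>m. X n = 0}"
    by (auto simp: returns_infinitely_often_def infinite_nat_iff_unbounded_le)
  also have "\<dots> \<in> sets path_space" by measurable
  finally show ?thesis .
qed

definition cylinders :: "(nat \<Rightarrow> int ^ ('d::finite)) set set" where
  "cylinders = insert {} (range (\<lambda>(n, x). {X. \<forall>i\<le>n. X i = x i}))"

lemma sets_path_space_eq: "sets path_space = sigma_sets UNIV cylinders"
proof
  let ?S = "sigma UNIV cylinders :: (nat \<Rightarrow> int ^ 'd) measure"
  have sets_S: "sets ?S = sigma_sets UNIV cylinders" by simp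
  have space_S: "space ?S = UNIV" by simp
  have "(\<lambda>X. X) \<in> measurable ?S path_space"
    unfolding path_space_def
  proof (rule measurable_PiM_single')
    fix i :: nat
    show "(\<lambda>X. X i) \<in> measurable ?S (count_space UNIV)"
    proof (subst measurable_count_space_eq2_countable, intro conjI ballI)
      fix a :: "int ^ 'd"
      have "(\<lambda>X. X i) -` {a} \<inter> space ?S =
        (\<Union>xs\<in>{xs. length xs = Suc i \<and> xs ! i = a}. {X. \<forall>j\<le>i. X j = xs ! j})"
      proof (intro set_eqI iffI)
        fix X assume X: "X \<in> (\<lambda>X. X i) -` {a} \<inter> space ?S"
        let ?xs = "map X [0..<Suc i]"
        have nth: "?xs ! j = X j" if "j \<le> i" for j
          using that nth_map_upt[of j "Suc i" 0 X] by simp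
        have "length ?xs = Suc i" "?xs ! i = a" using X nth[of i] by simp_all
        moreover have "X \<in> {X. \<forall>j\<le>i. X j = ?xs ! j}" using nth by simp
        ultimately show "X \<in> (\<Union>xs\<in>{xs. length xs = Suc i \<and> xs ! i = a}. {X. \<forall>j\<le>i. X j = xs ! j})"
          by blast
      qed auto
      also have "\<dots> \<in> sets ?S"
        unfolding sets_S
        by (intro sigma_sets_UNION countable_image) (auto simp: cylinders_def intro!: sigma_sets.Basic)
      finally show "(\<lambda>X. X i) -` {a} \<inter> space ?S \<in> sets ?S" .
    qed simp
  qed (simp add: space_PiM)
  from measurable_sets[OF this] show "sets path_space \<subseteq> sigma_sets UNIV (cylinders :: (nat \<Rightarrow> int ^ 'd) set set)"
    unfolding sets_S by auto
  have "A \<in> sets path_space" if A: "A \<in> cylinders" for A :: "(nat \<Rightarrow> int ^ 'd) set"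
  proof (cases "A = {}")
    case False
    with A obtain n x where x: "A = {X. \<forall>i\<le>n. X i = x i}" by (auto simp: cylinders_def)
    have "{X \<in> space path_space. \<forall>i\<le>n. X i = x i} \<in> sets path_space" by measurable
    then show ?thesis by (simp add: x)
  qed simp
  then show "sigma_sets UNIV cylinders \<subseteq> sets (path_space :: (nat \<Rightarrow> int ^ 'd) measure)"
    using sets.sigma_sets_subset[of cylinders path_space] by auto
qed

lemma Int_stable_cylinders: "Int_stable cylinders"
proof (rule Int_stableI)
  have aux: "{X. \<forall>i\<le>n. X i = x i} \<inter> {X. \<forall>i\<le>m. X i = y i} \<in> cylinders"
    if "n \<le> m" for n m and x y :: "nat \<Rightarrow> int ^ 'd"
  proof (cases "\<forall>i\<le>n. x i = y i")
    case True
    then have "{X. \<forall>i\<le>n. X i = x i} \<inter> {X. \<forall>i\<le>m. X i = y i} = {X. \<forall>i\<le>m. X i = y i}"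
      using that by auto
    then show ?thesis unfolding cylinders_def by (auto intro!: range_eqI[where x = "(m, y)"])
  next
    case False
    then obtain i where i: "i \<le> n" "x i \<noteq> y i" by auto
    have "{X. \<forall>i\<le>n. X i = x i} \<inter> {X. \<forall>i\<le>m. X i = y i} = {}"
    proof -
      have False if "\<forall>i\<le>n. X i = x i" "\<forall>i\<le>m. X i = y i" for X
        using i that \<open>n \<le> m\<close> by (metis order_trans)
      then show ?thesis by auto
    qed
    then show ?thesis by (simp add: cylinders_def)
  qed
  fix A B :: "(nat \<Rightarrow> int ^ 'd) set" assume AB: "A \<in> cylinders" "B \<in> cylinders"
  show "A \<inter> B \<in> cylinders"
  proof (cases "A = {} \<or> B = {}")
    case True
    then show ?thesis by (auto simp: cylinders_def)
  next
    case False
    with AB obtain n x m y where A: "A = {X. \<forall>i\<le>n. X i = x i}" and B: "B = {X. \<forall>i\<le>m. X i = y i}"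
      by (auto simp: cylinders_def)
    show ?thesis
      using aux[of n m x y] aux[of m n y x] unfolding A B by (cases "n \<le> m") (auto simp: Int_commute)
  qed
qed

lemma measurable_quenched_law: "quenched_law \<in> measurable config_space (prob_algebra path_space)"
proof (rule measurable_prob_algebra_generated[OF sets_path_space_eq Int_stable_cylinders])
  fix A :: "(nat \<Rightarrow> int ^ 'd) set" assume A: "A \<in> cylinders"
  show "(\<lambda>\<omega>. emeasure (quenched_law \<omega>) A) \<in> borel_measurable config_space"
  proof (cases "A = {}")
    case False
    with A obtain n x where "A = {X. \<forall>i\<le>n. X i = x i}" by (auto simp: cylinders_def)
    then show ?thesis by (simp add: emeasure_quenched_law_cylinder)
  qed simp
qed (simp_all add: prob_space_quenched_law)

lemma occupied_origin_in_sets [measurable]: "occupied_origin \<in> sets config_space"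
proof -
  have "occupied_origin = {\<omega> \<in> space config_space. \<omega> 0}" by (simp add: occupied_origin_def)
  also have "\<dots> \<in> sets config_space" by measurable
  finally show ?thesis .
qed

text \<open>The integral formula that defines the annealed law.\<close>

lemma emeasure_annealed_law:
  fixes Q :: "('d::finite) config measure"
  assumes "sets Q = sets config_space" and A: "A \<in> sets path_space"
  shows "emeasure (annealed_law Q) A = (\<integral>\<^sup>+ \<omega>. emeasure (quenched_law \<omega>) A \<partial>conditioned Q)"
proof -
  have sets: "sets (conditioned Q) = sets config_space" by (simp add: conditioned_def assms)
  have "space (conditioned Q) \<noteq> {}" using sets_eq_imp_space_eq[OF sets] by simp
  moreover have "quenched_law \<in> measurable (conditioned Q) (subprob_algebra path_space)"
    using measurable_prob_algebraD[OF measurable_quenched_law] by (simp add: measurable_cong_sets[OF sets])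
  ultimately show ?thesis unfolding annealed_law_def using A by (rule emeasure_bind)
qed

end

theory Submission
  imports Defs
begin

text \<open>By Poincare recurrence, almost surely every point has a neighbor in each of the
  \<open>2 d\<close> directions, so the walk is the simple random walk on a \<open>2 d\<close>-regular graph. On every
  axis-parallel line that meets a finite set \<open>A\<close> of points, the last point of \<open>A\<close> contributes a
  boundary edge; hence the boundary is at least as large as each coordinate projection of \<open>A\<close>,
  and the Loomis-Whitney inequality in three coordinates gives
  \<open>card A ^ 2 \<le> card (edge_boundary A) ^ 3\<close> for every such environment.

  Transience follows from this inequality by bounding the discounted Green function \<open>G\<close> of the
  starting point uniformly in the discount \<open>l < 1\<close>. The flux of \<open>G\<close> out of any finite set is
  bounded, so if the boundary of \<open>{y. t \<le> G y}\<close> is large, many boundary edges have a small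
  drop, and the superlevel set at a slightly smaller level is considerably larger. Iterating, the
  \<open>k\<close>-th superlevel set has at least order \<open>k ^ 3\<close> points while the \<open>k\<close>-th decrement is of order
  \<open>1 / k ^ 2\<close>. These decrements are summable, so a large \<open>G start\<close> would make a superlevel set
  at a positive level infinite.\<close>

section \<open>Isoperimetry and the Green function of a regular graph\<close>

text \<open>The graph is constrained only on \<open>V\<close>: off the occupied sites
  \<open>neighbors\<close> takes values that carry no meaning. Symmetry and constant degree together
  make the transition matrix on \<open>V\<close> symmetric.\<close>

locale regular_walk =
  fixes nb :: "'a \<Rightarrow> 'a set" and V :: "'a set" and N :: nat and start :: 'a
  assumes start: "start \<in> V"
    and nb_closed: "x \<in> V \<Longrightarrow> nb x \<subseteq> V"
    and N_pos: "0 < N"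
    and card_nb: "x \<in> V \<Longrightarrow> card (nb x) = N"
    and nb_sym: "x \<in> V \<Longrightarrow> y \<in> V \<Longrightarrow> y \<in> nb x \<longleftrightarrow> x \<in> nb y"
begin

primrec walk_law :: "nat \<Rightarrow> 'a pmf" where
  "walk_law 0 = return_pmf start"
| "walk_law (Suc n) = walk_law n \<bind> (\<lambda>x. pmf_of_set (nb x))"

definition edge_boundary :: "'a set \<Rightarrow> ('a \<times> 'a) set" where
  "edge_boundary A = {(x, y). x \<in> A \<and> y \<in> nb x \<and> y \<notin> A}"

text \<open>The Green function seen from \<open>start\<close>. For \<open>0 < l < 1\<close> the
  discount makes the series converge whether or not the walk is transient; letting \<open>l\<close>
  tend to \<open>1\<close> recovers the expected number of visits.\<close>

definition green :: "real \<Rightarrow> 'a \<Rightarrow> real" where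
  "green l y = (\<Sum>n. l ^ n * pmf (walk_law n) y)"

definition superlevel :: "real \<Rightarrow> real \<Rightarrow> 'a set" where
  "superlevel l t = {y. t \<le> green l y}"

lemma finite_nb: "x \<in> V \<Longrightarrow> finite (nb x)"
  using card_nb[of x] N_pos by (simp add: card_ge_0_finite)

lemma set_walk_law: "set_pmf (walk_law n) \<subseteq> V"
proof (induction n)
  case (Suc n)
  have "set_pmf (pmf_of_set (nb x)) \<subseteq> V" if "x \<in> V" for x
  proof -
    have "nb x \<noteq> {}" using card_nb[OF that] N_pos by auto
    then show ?thesis using nb_closed[OF that] finite_nb[OF that] by simp
  qed
  with Suc show ?case by (auto simp: set_bind_pmf)
qed (simp add: start)

text \<open>Since the transition matrix is symmetric, the forward evolution of the law is averaging
  over the neighbors of the target. This turns the recursion for \<open>walk_law\<close> into a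
  discrete Laplace equation for \<open>green\<close>.\<close>

lemma pmf_walk_law_Suc:
  assumes y: "y \<in> V"
  shows "pmf (walk_law (Suc n)) y = (\<Sum>x\<in>nb y. pmf (walk_law n) x) / real N"
proof -
  have step: "pmf (pmf_of_set (nb x)) y = (if x \<in> nb y then 1 / real N else 0)" if "x \<in> V" for x
  proof -
    have "nb x \<noteq> {}" using card_nb[OF that] N_pos by auto
    then show ?thesis
      using finite_nb[OF that] nb_sym[OF that y] card_nb[OF that] by (simp add: indicator_def)
  qed
  have "pmf (walk_law (Suc n)) y = (\<integral>x. pmf (pmf_of_set (nb x)) y \<partial>measure_pmf (walk_law n))"
    by (simp add: pmf_bind)
  also have "\<dots> = (\<Sum>x\<in>nb y. pmf (pmf_of_set (nb x)) y * pmf (walk_law n) x)"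
  proof (rule integral_measure_pmf_real[OF finite_nb[OF y]])
    fix x assume "x \<in> set_pmf (walk_law n)" "pmf (pmf_of_set (nb x)) y \<noteq> 0"
    then show "x \<in> nb y" using step set_walk_law[of n] by (auto split: if_splits)
  qed
  also have "\<dots> = (\<Sum>x\<in>nb y. pmf (walk_law n) x / real N)"
    using nb_closed[OF y] step by (intro sum.cong) auto
  finally show ?thesis by (simp add: sum_divide_distrib)
qed

section \<open>The discounted Green function: balance equation and total mass\<close>

context
  fixes l :: real
  assumes l: "0 < l" "l < 1"
begin

lemma summable_green: "summable (\<lambda>n. l ^ n * pmf (walk_law n) y)"
  using l by (intro summable_comparison_test'[OF summable_geometric[of l], of 0])
    (auto simp: abs_mult pmf_le_1 intro!: mult_left_le)

lemma green_nonneg: "0 \<le> green l y"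
  unfolding green_def using l by (intro suminf_nonneg summable_green) auto

lemma green_pos_in_V: "0 < green l y \<Longrightarrow> y \<in> V"
proof (rule ccontr)
  assume "0 < green l y" "y \<notin> V"
  then have "pmf (walk_law n) y = 0" for n
    using set_walk_law[of n] by (auto simp: set_pmf_iff)
  then show False using \<open>0 < green l y\<close> by (simp add: green_def)
qed

text \<open>Splitting off time \<open>0\<close> leaves the series shifted by one step, which
  \<open>pmf_walk_law_Suc\<close> expresses through the neighbors of \<open>y\<close>.\<close>

lemma green_eq:
  assumes y: "y \<in> V"
  shows "green l y = (if y = start then 1 else 0) + l / real N * (\<Sum>x\<in>nb y. green l x)"
proof -
  have "(\<Sum>x\<in>nb y. green l x) = (\<Sum>n. \<Sum>x\<in>nb y. l ^ n * pmf (walk_law n) x)"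
    unfolding green_def by (rule suminf_sum[symmetric]) (rule summable_green)
  moreover have "summable (\<lambda>n. \<Sum>x\<in>nb y. l ^ n * pmf (walk_law n) x)"
    by (rule summable_sum) (rule summable_green)
  ultimately have "l / real N * (\<Sum>x\<in>nb y. green l x) =
      (\<Sum>n. l / real N * (\<Sum>x\<in>nb y. l ^ n * pmf (walk_law n) x))"
    by (simp only: suminf_mult)
  also have "\<dots> = (\<Sum>n. l ^ Suc n * pmf (walk_law (Suc n)) y)"
    unfolding pmf_walk_law_Suc[OF y] by (simp add: sum_distrib_left sum_divide_distrib mult_ac)
  finally show ?thesis
    unfolding green_def using suminf_split_head[OF summable_green[of y]] by simp
qed

lemma sum_green_le:
  assumes "finite A"
  shows "(\<Sum>y\<in>A. green l y) \<le> 1 / (1 - l)"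
proof -
  have "(\<Sum>y\<in>A. green l y) = (\<Sum>n. \<Sum>y\<in>A. l ^ n * pmf (walk_law n) y)"
    unfolding green_def by (rule suminf_sum[symmetric]) (rule summable_green)
  also have "\<dots> \<le> (\<Sum>n. l ^ n)"
  proof (rule suminf_le)
    fix n
    have "(\<Sum>y\<in>A. pmf (walk_law n) y) \<le> 1"
      using measure_measure_pmf_finite[OF assms, of "walk_law n"] by (metis measure_pmf.prob_le_1)
    then show "(\<Sum>y\<in>A. l ^ n * pmf (walk_law n) y) \<le> l ^ n"
      using l by (simp add: sum_distrib_left[symmetric] mult_left_le)
    show "summable (\<lambda>n. \<Sum>y\<in>A. l ^ n * pmf (walk_law n) y)"
      by (rule summable_sum) (rule summable_green)
  qed (use l in \<open>auto intro: summable_geometric\<close>)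
  also have "\<dots> = 1 / (1 - l)" using l by (simp add: suminf_geometric)
  finally show ?thesis .
qed

lemma card_subset_superlevel_le:
  assumes "0 < t" "finite A" "A \<subseteq> superlevel l t"
  shows "real (card A) \<le> 1 / (t * (1 - l))"
proof -
  have "real (card A) * t \<le> (\<Sum>y\<in>A. green l y)"
    using assms(3) by (intro sum_bounded_below) (auto simp: superlevel_def)
  also have "\<dots> \<le> 1 / (1 - l)" by (rule sum_green_le[OF assms(2)])
  finally show ?thesis using assms(1) l by (simp add: field_simps)
qed

lemma finite_superlevel:
  assumes "0 < t"
  shows "finite (superlevel l t)"
proof (rule ccontr)
  obtain m where m: "1 / (t * (1 - l)) < real m" using reals_Archimedean2 by blast
  assume "infinite (superlevel l t)"
  then obtain A where "finite A" "card A = m" "A \<subseteq> superlevel l t"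
    using infinite_arbitrarily_large by blast
  with card_subset_superlevel_le[OF assms] m show False by fastforce
qed

lemma superlevel_subset_V: "0 < t \<Longrightarrow> superlevel l t \<subseteq> V"
  using green_pos_in_V by (force simp: superlevel_def)

section \<open>Flux through the boundary and growth of superlevel sets\<close>

lemma finite_edge_boundary:
  assumes "finite A" "A \<subseteq> V"
  shows "finite (edge_boundary A)"
  by (rule finite_subset[of _ "Sigma A nb"]) (use assms finite_nb in \<open>auto simp: edge_boundary_def\<close>)

text \<open>Edges inside \<open>A\<close> occur in both orientations and cancel, so the flux equals
  the sum over \<open>A\<close> of the negative Laplacian of \<open>green l\<close>. By
  \<open>green_eq\<close> and \<open>l < 1\<close> this is at most \<open>N\<close> at
  \<open>start\<close> and at most \<open>0\<close> elsewhere, which makes the bound independent of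
  \<open>l\<close> and \<open>A\<close>.\<close>

lemma flux_le:
  assumes A: "finite A" "A \<subseteq> V"
  shows "(\<Sum>(x, y)\<in>edge_boundary A. green l x - green l y) \<le> real N"
proof -
  let ?G = "green l"
  let ?I = "Sigma A (\<lambda>x. nb x \<inter> A)"
  have fin: "finite (nb x)" if "x \<in> A" for x using that A finite_nb by auto
  have S: "Sigma A nb = ?I \<union> edge_boundary A" "?I \<inter> edge_boundary A = {}"
    by (auto simp: edge_boundary_def)
  have finI: "finite ?I" using A fin by auto
  have "(\<Sum>(x, y)\<in>?I. ?G x) = (\<Sum>(x, y)\<in>?I. ?G y)"
    by (rule sum.reindex_bij_witness[of _ prod.swap prod.swap])
      (use A nb_sym in \<open>auto simp: subset_iff\<close>)
  then have I0: "(\<Sum>(x, y)\<in>?I. ?G x - ?G y) = 0"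
    by (simp add: case_prod_unfold sum_subtractf)
  have "(\<Sum>(x, y)\<in>edge_boundary A. ?G x - ?G y) = (\<Sum>(x, y)\<in>Sigma A nb. ?G x - ?G y)"
    unfolding S(1) sum.union_disjoint[OF finI finite_edge_boundary[OF A] S(2)] I0 by simp
  also have "\<dots> = (\<Sum>x\<in>A. \<Sum>y\<in>nb x. ?G x - ?G y)"
    using A fin by (subst sum.Sigma) auto
  also have "\<dots> \<le> (\<Sum>x\<in>A. if x = start then real N else 0)"
  proof (rule sum_mono)
    fix x assume x: "x \<in> A"
    then have xV: "x \<in> V" using A by auto
    have "l * (\<Sum>y\<in>nb x. ?G y) \<le> (\<Sum>y\<in>nb x. ?G y)"
      using l by (intro mult_left_le_one_le sum_nonneg green_nonneg) auto
    moreover have "real N * ?G x = (if x = start then real N else 0) + l * (\<Sum>y\<in>nb x. ?G y)"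
      unfolding green_eq[OF xV] using N_pos by (simp add: field_simps)
    ultimately show "(\<Sum>y\<in>nb x. ?G x - ?G y) \<le> (if x = start then real N else 0)"
      by (simp add: sum_subtractf card_nb[OF xV])
  qed
  also have "\<dots> \<le> real N" using A by simp
  finally show ?thesis .
qed

text \<open>The flux bound forces at least half of the boundary edges to have a drop of at most
  \<open>s\<close>; each of their outer endpoints lies in the next superlevel set and is shared by at most
  \<open>N\<close> of these edges.\<close>

lemma card_superlevel_grow:
  assumes t: "0 < s" "s < t"
    and B: "2 * real N \<le> s * real (card (edge_boundary (superlevel l t)))"
  shows "real (card (superlevel l t)) + real (card (edge_boundary (superlevel l t))) / (2 * real N)
    \<le> real (card (superlevel l (t - s)))"
proof -
  let ?G = "green l" and ?A = "superlevel l t" and ?A' = "superlevel l (t - s)"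
  let ?E = "edge_boundary ?A"
  define L where "L = {p \<in> ?E. s < ?G (fst p) - ?G (snd p)}"
  have A: "finite ?A" "?A \<subseteq> V" and A': "finite ?A'" "?A' \<subseteq> V"
    using t finite_superlevel[of t] superlevel_subset_V[of t]
      finite_superlevel[of "t - s"] superlevel_subset_V[of "t - s"] by auto
  have E: "finite ?E" by (rule finite_edge_boundary[OF A])
  have L: "L \<subseteq> ?E" "finite L" using E by (auto simp: L_def)
  have "s * real (card L) \<le> (\<Sum>p\<in>L. ?G (fst p) - ?G (snd p))"
    using sum_bounded_below[of L s "\<lambda>p. ?G (fst p) - ?G (snd p)"]
    by (auto simp: L_def mult.commute less_imp_le)
  \<comment> \<open>The added terms are nonnegative: along a boundary edge of a superlevel set,
    \<open>?G\<close> falls from at least \<open>t\<close> to below \<open>t\<close>.\<close>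
  also have "\<dots> \<le> (\<Sum>p\<in>?E. ?G (fst p) - ?G (snd p))"
    by (rule sum_mono2[OF E L(1)]) (auto simp: edge_boundary_def superlevel_def)
  also have "\<dots> \<le> real N" using flux_le[OF A] by (simp add: case_prod_unfold)
  finally have "2 * (s * real (card L)) \<le> s * real (card ?E)" using B by linarith
  then have "2 * real (card L) \<le> real (card ?E)" using t by simp
  then have half: "real (card ?E) / 2 \<le> real (card (?E - L))"
    using card_Diff_subset[OF L(2,1)] card_mono[OF E L(1)] by (simp add: of_nat_diff)
  have "?E - L \<subseteq> (\<Union>y\<in>?A' - ?A. nb y \<times> {y})"
  proof
    fix p assume p: "p \<in> ?E - L"
    then obtain x y where xy: "p = (x, y)" "x \<in> ?A" "y \<in> nb x" "y \<notin> ?A" "?G x - ?G y \<le> s"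
      by (auto simp: edge_boundary_def L_def)
    moreover have "y \<in> ?A'" using xy by (auto simp: superlevel_def)
    moreover have "x \<in> nb y" using xy A A' \<open>y \<in> ?A'\<close> nb_sym by blast
    ultimately show "p \<in> (\<Union>y\<in>?A' - ?A. nb y \<times> {y})" by auto
  qed
  then have "card (?E - L) \<le> card (\<Union>y\<in>?A' - ?A. nb y \<times> {y})"
    using A' finite_nb by (intro card_mono) auto
  also have "\<dots> \<le> (\<Sum>y\<in>?A' - ?A. card (nb y \<times> {y}))"
    using A' by (intro card_UN_le) auto
  also have "\<dots> = card (?A' - ?A) * N"
    using A' card_nb by (subst sum.cong[OF refl, of _ _ "\<lambda>_. N"]) (auto simp: card_cartesian_product)
  finally have "real (card (?E - L)) \<le> real (card (?A' - ?A)) * real N"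
    by (metis of_nat_le_iff of_nat_mult)
  with half have "real (card ?E) / 2 \<le> real (card (?A' - ?A)) * real N" by linarith
  then have "real (card ?E) / (2 * real N) \<le> real (card (?A' - ?A))"
    using N_pos by (simp add: field_simps)
  moreover have "?A \<subseteq> ?A'" using t by (auto simp: superlevel_def)
  then have "real (card ?A') = real (card ?A) + real (card (?A' - ?A))"
    using A A' by (metis card_Diff_subset card_mono le_add_diff_inverse of_nat_add)
  ultimately show ?thesis by linarith
qed

text \<open>If the bound failed, the levels \<open>t k\<close> would decrease from
  \<open>green l start\<close> by the telescoping amounts \<open>D / (k * (k + 1))\<close> and stay
  above the positive number \<open>green l start - D\<close>. Isoperimetry and
  \<open>card_superlevel_grow\<close> make the superlevel sets grow like \<open>k ^ 3\<close>, while
  the total mass of \<open>green l\<close> bounds their size.\<close>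

lemma green_start_le:
  assumes iso: "\<And>A. finite A \<Longrightarrow> A \<noteq> {} \<Longrightarrow> A \<subseteq> V \<Longrightarrow> card A ^ 2 \<le> card (edge_boundary A) ^ 3"
  shows "green l start \<le> 784 * real N ^ 3"
proof (rule ccontr)
  \<comment> \<open>The constants are tuned so that \<open>1 / (2 * N) = 7 * a\<close>, matching
    \<open>(k + 1) ^ 3 \<le> k ^ 3 + 7 * k ^ 2\<close>, and so that
    \<open>D * a\<^sup>2 = 4 * N\<close>, which meets the threshold of
    \<open>card_superlevel_grow\<close> with a factor \<open>2\<close> to spare for
    \<open>k / (k + 1)\<close>.\<close>
  define a where "a = 1 / (14 * real N)"
  define D where "D = 784 * real N ^ 3"
  define t where "t k = green l start - D * (1 - 1 / real k)" for k
  assume "\<not> green l start \<le> 784 * real N ^ 3"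
  then have eps: "0 < green l start - D" by (simp add: D_def)
  have a: "0 < a" "a \<le> 1" using N_pos by (auto simp: a_def field_simps)
  have D: "0 < D" "D * a\<^sup>2 = 4 * real N" using N_pos by (auto simp: a_def D_def field_simps power2_eq_square power3_eq_cube)
  have t_gt: "green l start - D < t k" if "1 \<le> k" for k
    using D(1) that unfolding t_def by (auto simp: algebra_simps)
  have grow: "(a * real k) ^ 3 \<le> real (card (superlevel l (t k)))" if "1 \<le> k" for k
    using that
  proof (induction k rule: dec_induct)
    case base
    \<comment> \<open>Indexing begins at \<open>1\<close> because
      \<open>t 1 = green l start\<close>, the level that \<open>start\<close> itself
      attains.\<close>
    have "0 < t 1" using t_gt[of 1] eps by simp
    then have "finite (superlevel l (t 1))" by (rule finite_superlevel)
    moreover have "start \<in> superlevel l (t 1)" by (simp add: superlevel_def t_def)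
    ultimately have "1 \<le> card (superlevel l (t 1))" 
      by (metis One_nat_def Suc_leI card_gt_0_iff empty_iff)
    moreover have "a ^ 3 \<le> 1" using a by (simp add: power_le_one)
    ultimately show ?case by simp
  next
    case (step k)
    define s where "s = D / (real k * (real k + 1))"
    have k: "1 \<le> real k" using step by simp
    let ?A = "superlevel l (t k)"
    let ?B = "real (card (edge_boundary ?A))"
    have "1 / (real k * (real k + 1)) = 1 / real k - 1 / (real k + 1)"
      using k by (simp add: divide_simps)
    then have "s = D * (1 / real k - 1 / (real k + 1))"
      unfolding s_def by (metis mult.right_neutral times_divide_eq_right)
    then have ts: "t k - s = t (Suc k)" by (simp add: t_def algebra_simps)
    have pos: "0 < t k" "0 < t (Suc k)" using t_gt[of k] t_gt[of "Suc k"] step eps by auto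
    have "real (card ?A) > 0" using step.IH a k
      by (smt (verit) mult_pos_pos zero_less_power)
    then have "?A \<noteq> {}" by auto
    have "card ?A ^ 2 \<le> card (edge_boundary ?A) ^ 3"
      by (rule iso) (use \<open>?A \<noteq> {}\<close> pos finite_superlevel superlevel_subset_V in auto)
    then have "real (card ?A) ^ 2 \<le> ?B ^ 3" by (metis of_nat_le_iff of_nat_power)
    \<comment> \<open>Both sides become cubes, so the isoperimetric inequality yields a boundary of
      order \<open>k ^ 2\<close> after taking cube roots.\<close>
    moreover have "((a * real k) ^ 3)\<^sup>2 \<le> real (card ?A) ^ 2"
      using step.IH a by (intro power_mono) auto
    ultimately have "((a * real k)\<^sup>2) ^ 3 \<le> ?B ^ 3"
      by (simp add: power_mult[symmetric])
    then have B: "(a * real k)\<^sup>2 \<le> ?B" by (subst (asm) power_mono_iff) auto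
    have "2 * real N \<le> s * (a * real k)\<^sup>2"
    proof -
      have "s * (a * real k)\<^sup>2 = (D * a\<^sup>2) * real k / (real k + 1)"
        using k by (simp add: s_def divide_simps power2_eq_square)
      \<comment> \<open>The last factor is at least \<open>1\<close> because
        \<open>k \<ge> 1\<close>.\<close>
      also have "\<dots> = 2 * real N * (2 * real k / (real k + 1))" by (simp add: D)
      also have "\<dots> \<ge> 2 * real N * 1" using k by (intro mult_left_mono) auto
      finally show ?thesis by simp
    qed
    also have "\<dots> \<le> s * ?B" using B k D by (intro mult_left_mono) (auto simp: s_def)
    finally have "real (card ?A) + ?B / (2 * real N) \<le> real (card (superlevel l (t k - s)))"
      by (intro card_superlevel_grow) (use pos ts k D in \<open>auto simp: s_def\<close>)
    moreover have "7 * a ^ 3 * (real k)\<^sup>2 \<le> ?B / (2 * real N)"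
    proof -
      have "7 * a ^ 3 * (real k)\<^sup>2 = (a * real k)\<^sup>2 / (2 * real N)"
        using N_pos by (simp add: a_def field_simps power2_eq_square power3_eq_cube)
      then show ?thesis using B N_pos by (simp add: divide_right_mono)
    qed
    moreover have "(a * real (Suc k)) ^ 3 \<le> (a * real k) ^ 3 + 7 * a ^ 3 * (real k)\<^sup>2"
    proof -
      have "real k \<le> (real k)\<^sup>2" "1 \<le> (real k)\<^sup>2"
        using k by (auto simp: power2_eq_square intro: mult_ge1_I)
      then have "(real (Suc k)) ^ 3 \<le> real k ^ 3 + 7 * (real k)\<^sup>2"
        by (simp add: power3_eq_cube power2_eq_square algebra_simps)
      from mult_left_mono[OF this, of "a ^ 3"] show ?thesis
        using a unfolding power_mult_distrib by (simp add: distrib_left mult_ac)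
    qed
    ultimately show ?case using step.IH ts by simp
  qed
  \<comment> \<open>All the superlevel sets lie in the one at the limiting level
    \<open>green l start - D\<close>, whose finite subsets have at most \<open>M\<close> elements.
    \<open>M\<close> may depend on \<open>l\<close>, since it serves only to contradict unbounded
    growth.\<close>
  define M where "M = 1 / ((green l start - D) * (1 - l))"
  have bounded: "(a * real k) ^ 3 \<le> M" if "1 \<le> k" for k
  proof -
    have "superlevel l (t k) \<subseteq> superlevel l (green l start - D)"
      using t_gt[OF that] by (auto simp: superlevel_def)
    moreover have "finite (superlevel l (t k))" using t_gt[OF that] eps by (intro finite_superlevel) auto
    ultimately have "real (card (superlevel l (t k))) \<le> M"
      unfolding M_def by (intro card_subset_superlevel_le[OF eps])
    with grow[OF that] show ?thesis by linarith
  qed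
  obtain k where k: "(M + 1) / a < real k" using reals_Archimedean2 by blast
  have "0 < M" using eps l by (simp add: M_def)
  have kM: "M + 1 < a * real k" using k a by (simp add: field_simps)
  then have "0 < real k" using \<open>0 < M\<close> a by (smt (verit) mult_nonneg_nonpos)
  moreover have "a * real k \<le> (a * real k) ^ 3"
    using kM \<open>0 < M\<close> by (intro self_le_power) auto
  ultimately show False using bounded[of k] kM by simp
qed

end

text \<open>A partial sum of the Green series is a polynomial in \<open>l\<close>, so the bound of
  \<open>green_start_le\<close>, being uniform in \<open>l\<close>, passes to the limit
  \<open>l = 1\<close> from the left.\<close>

theorem summable_return_probability:
  assumes iso: "\<And>A. finite A \<Longrightarrow> A \<noteq> {} \<Longrightarrow> A \<subseteq> V \<Longrightarrow> card A ^ 2 \<le> card (edge_boundary A) ^ 3"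
  shows "summable (\<lambda>n. pmf (walk_law n) start)"
proof (rule bounded_imp_summable)
  fix m
  let ?f = "\<lambda>l. \<Sum>n\<le>m. l ^ n * pmf (walk_law n) start"
  have le: "?f l \<le> 784 * real N ^ 3" if l: "0 < l" "l < 1" for l
  proof -
    have "?f l \<le> green l start"
      unfolding green_def using l by (intro sum_le_suminf summable_green) auto
    also have "\<dots> \<le> 784 * real N ^ 3" by (rule green_start_le[OF l iso])
    finally show ?thesis .
  qed
  have "(?f \<longlongrightarrow> ?f 1) (at_left 1)" by (intro tendsto_intros)
  moreover have "\<forall>\<^sub>F l in at_left 1. ?f l \<le> 784 * real N ^ 3"
    using eventually_at_left_real[of 0 "1 :: real"] by (rule eventually_mono[OF _ le]) auto
  ultimately have "?f 1 \<le> 784 * real N ^ 3"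
    by (rule tendsto_upperbound) simp
  then show "(\<Sum>n\<le>m. pmf (walk_law n) start) \<le> 784 * real N ^ 3" by simp
qed simp

end

section \<open>Isoperimetry of the discrete point process\<close>

text \<open>Slice \<open>A\<close> by its third coordinate. A slice \<open>S z\<close> has at most
  \<open>card P\<close> and at most \<open>card (X z) * card (Y z)\<close> points, hence at most the
  geometric mean of the two. Summing over \<open>z\<close> and applying Cauchy-Schwarz to the square
  roots gives the product of the three projections.\<close>

lemma loomis_whitney:
  fixes A :: "('a \<times> 'b \<times> 'c) set"
  assumes A: "finite A"
  shows "card A ^ 2 \<le> card ((\<lambda>(x, y, z). (x, y)) ` A) * card ((\<lambda>(x, y, z). (x, z)) ` A)
    * card ((\<lambda>(x, y, z). (y, z)) ` A)"
proof -
  define C where "C = (\<lambda>(x, y, z). z) ` A"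
  define P where "P = (\<lambda>(x, y, z). (x, y)) ` A"
  define X where "X z = {x. \<exists>y. (x, y, z) \<in> A}" for z
  define Y where "Y z = {y. \<exists>x. (x, y, z) \<in> A}" for z
  define S where "S z = {(x, y). (x, y, z) \<in> A}" for z
  have C: "finite C" and P: "finite P" using A by (auto simp: C_def P_def)
  have X: "finite (X z)" for z
    by (rule finite_subset[OF _ finite_imageI[OF A, of fst]]) (force simp: X_def)
  have Y: "finite (Y z)" for z
    by (rule finite_subset[OF _ finite_imageI[OF A, of "\<lambda>p. fst (snd p)"]]) (force simp: Y_def)
  have SP: "S z \<subseteq> P" and SXY: "S z \<subseteq> X z \<times> Y z" for z
    by (force simp: S_def P_def X_def Y_def)+
  have S: "finite (S z)" for z using SP P finite_subset by blast
  have "A = (\<Union>z\<in>C. (\<lambda>(x, y). (x, y, z)) ` S z)"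
    by (force simp: C_def S_def)
  then have "card A \<le> (\<Sum>z\<in>C. card (S z))"
    using card_UN_le[OF C, of "\<lambda>z. (\<lambda>(x, y). (x, y, z)) ` S z"] card_image_le[OF S]
    by (smt (verit, best) le_trans sum_mono)
  have "(\<lambda>(x, y, z). (x, z)) ` A = prod.swap ` Sigma C X"
    by (force simp: C_def X_def image_iff)
  then have XA: "card ((\<lambda>(x, y, z). (x, z)) ` A) = (\<Sum>z\<in>C. card (X z))"
    using C X by (simp add: card_image)
  have "(\<lambda>(x, y, z). (y, z)) ` A = prod.swap ` Sigma C Y"
    by (force simp: C_def Y_def image_iff)
  then have YA: "card ((\<lambda>(x, y, z). (y, z)) ` A) = (\<Sum>z\<in>C. card (Y z))"
    using C Y by (simp add: card_image)
  let ?x = "\<lambda>z. sqrt (real (card (X z)))" and ?y = "\<lambda>z. sqrt (real (card (Y z)))"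
  have S_le: "real (card (S z)) \<le> sqrt (real (card P)) * (?x z * ?y z)" for z
  proof -
    have "card (S z) \<le> card P" "card (S z) \<le> card (X z) * card (Y z)"
      using card_mono[OF P SP] card_mono[OF _ SXY] X Y by (auto simp: card_cartesian_product)
    then have "card (S z) * card (S z) \<le> card P * (card (X z) * card (Y z))" by (rule mult_le_mono)
    then have "real (card (S z)) ^ 2 \<le> real (card P) * (real (card (X z)) * real (card (Y z)))"
      by (metis of_nat_le_iff of_nat_mult power2_eq_square)
    then show ?thesis by (simp add: real_le_rsqrt real_sqrt_mult[symmetric])
  qed
  have "real (card A) \<le> (\<Sum>z\<in>C. real (card (S z)))"
    using \<open>card A \<le> _\<close> by (metis of_nat_le_iff of_nat_sum)
  also have "\<dots> \<le> sqrt (real (card P)) * (\<Sum>z\<in>C. ?x z * ?y z)"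
    unfolding sum_distrib_left by (intro sum_mono S_le)
  finally have "real (card A) ^ 2 \<le> (sqrt (real (card P)) * (\<Sum>z\<in>C. ?x z * ?y z)) ^ 2"
    by (intro power_mono) auto
  also have "\<dots> = real (card P) * (\<Sum>z\<in>C. ?x z * ?y z) ^ 2"
    by (simp add: power_mult_distrib)
  also have "\<dots> \<le> real (card P) * ((\<Sum>z\<in>C. (?x z)\<^sup>2) * (\<Sum>z\<in>C. (?y z)\<^sup>2))"
    by (intro mult_left_mono Cauchy_Schwarz_ineq_sum) auto
  also have "\<dots> = real (card P * (\<Sum>z\<in>C. card (X z)) * (\<Sum>z\<in>C. card (Y z)))" by simp
  finally show ?thesis
    unfolding XA YA P_def[symmetric] by (metis of_nat_le_iff of_nat_power)
qed

section \<open>The neighbor graph of a configuration and its boundary\<close>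

lemma uminus_units: "e \<in> units \<Longrightarrow> - e \<in> units"
  by (auto simp: units_def)

text \<open>The regularity of the environment on which the deterministic part of the argument rests.
  It makes every \<open>LEAST\<close> in \<open>first_hit\<close> at an occupied site well
  defined.\<close>

definition two_sided :: "('d::finite) config \<Rightarrow> bool" where
  "two_sided \<omega> \<longleftrightarrow> (\<forall>x. \<omega> x \<longrightarrow> (\<forall>e\<in>units. \<exists>k>0. \<omega> (x + int k *s e)))"

text \<open>Rewrites the first hit as an occupied endpoint behind an empty gap, a form that can be
  read from either end of the edge.\<close>

lemma neighbors_iff:
  assumes "two_sided \<omega>" "\<omega> x"
  shows "y \<in> neighbors x \<omega> \<longleftrightarrow> (\<exists>e\<in>units. \<exists>k>0. y = x + int k *s e \<and> \<omega> y \<and>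
    (\<forall>j. 0 < j \<and> j < k \<longrightarrow> \<not> \<omega> (x + int j *s e)))"
proof -
  have ex: "\<exists>k. 0 < k \<and> \<omega> (x + int k *s e)" if "e \<in> units" for e
    using assms that by (auto simp: two_sided_def)
  have hit: "first_hit e (shift_by x \<omega>) = k \<longleftrightarrow> 0 < k \<and> \<omega> (x + int k *s e) \<and>
      (\<forall>j. 0 < j \<and> j < k \<longrightarrow> \<not> \<omega> (x + int j *s e))" if e: "e \<in> units" for e k
  proof -
    let ?P = "\<lambda>k. 0 < k \<and> \<omega> (x + int k *s e)"
    have "(LEAST k. ?P k) = k \<longleftrightarrow> ?P k \<and> (\<forall>j. ?P j \<longrightarrow> k \<le> j)"
      using LeastI_ex[OF ex[OF e]] Least_le[of ?P] Least_equality[of ?P k] by blast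
    then show ?thesis by (auto simp: first_hit_def shift_by_def not_less[symmetric])
  qed
  show ?thesis
    unfolding neighbors_def image_iff using hit by metis
qed

text \<open>Seen from \<open>y\<close> in direction \<open>- e\<close>, the gap is the same set of
  sites in reverse order: distance \<open>j\<close> from \<open>y\<close> is distance
  \<open>k - j\<close> from \<open>x\<close>.\<close>

lemma neighbors_sym:
  assumes "two_sided \<omega>" "\<omega> x" "\<omega> y" "y \<in> neighbors x \<omega>"
  shows "x \<in> neighbors y \<omega>"
proof -
  obtain e k where e: "e \<in> units" "0 < k" "y = x + int k *s e"
    and gap: "\<And>j. 0 < j \<Longrightarrow> j < k \<Longrightarrow> \<not> \<omega> (x + int j *s e)"
    using assms(4) unfolding neighbors_iff[OF assms(1,2)] by blast
  have rev_eq: "y + int j *s (- e) = x + int (k - j) *s e" if "j \<le> k" for j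
    using that by (simp add: e(3) vec_eq_iff algebra_simps of_nat_diff)
  have "\<not> \<omega> (y + int j *s (- e))" if "0 < j" "j < k" for j
    using gap[of "k - j"] that by (subst rev_eq) auto
  moreover have "x = y + int k *s (- e)" by (subst rev_eq) auto
  ultimately show ?thesis
    unfolding neighbors_iff[OF assms(1,3)] using uminus_units[OF e(1)] e(2) assms(2) by blast
qed

text \<open>The projection along direction \<open>i\<close>, encoded by setting the coordinate to
  \<open>0\<close> so that its values keep the same type. Its fibers are the lines in direction
  \<open>i\<close>.\<close>

definition drop_coord :: "'d \<Rightarrow> int ^ 'd \<Rightarrow> int ^ ('d::finite)" where
  "drop_coord i x = (\<chi> j. if j = i then 0 else x $ j)"

text \<open>On every line in direction \<open>axis i 1\<close> that meets \<open>A\<close>, the last point of \<open>A\<close> has its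
  neighbor outside \<open>A\<close>.\<close>

lemma drop_coord_subset_boundary:
  fixes A :: "(int ^ 'd::finite) set"
  assumes \<omega>: "two_sided \<omega>" and A: "finite A" "A \<subseteq> points \<omega>"
  shows "drop_coord i ` A \<subseteq> (\<lambda>(x, y). drop_coord i x) ` {(x, y). x \<in> A \<and> y \<in> neighbors x \<omega> \<and> y \<notin> A}"
proof
  fix c assume "c \<in> drop_coord i ` A"
  then obtain z where z: "z \<in> A" "c = drop_coord i z" by auto
  let ?L = "{x \<in> A. drop_coord i x = c}"
  have "finite ?L" "?L \<noteq> {}" using A z by auto
  then have "Max ((\<lambda>x. x $ i) ` ?L) \<in> (\<lambda>x. x $ i) ` ?L" by (intro Max_in) auto
  then obtain x where x: "x \<in> ?L" and "Max ((\<lambda>x. x $ i) ` ?L) = x $ i" by blast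
  then have max: "y $ i \<le> x $ i" if "y \<in> ?L" for y
    using that \<open>finite ?L\<close> by (metis (no_types, lifting) Max_ge finite_imageI imageI)
  have e: "axis i 1 \<in> (units :: (int ^ 'd) set)" by (simp add: units_def)
  define k where "k = first_hit (axis i 1) (shift_by x \<omega>)"
  define y where "y = x + int k *s axis i 1"
  have "\<omega> x" using x A by (auto simp: points_def)
  then have "\<exists>k. 0 < k \<and> \<omega> (x + int k *s axis i 1)" using \<omega> e by (auto simp: two_sided_def)
  then have "0 < k"
    using LeastI_ex[of "\<lambda>k. 0 < k \<and> \<omega> (x + int k *s axis i 1)"]
    by (auto simp: k_def first_hit_def shift_by_def)
  have "y \<in> neighbors x \<omega>" using e by (auto simp: y_def k_def neighbors_def)
  moreover have "y \<notin> A"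
  proof
    assume "y \<in> A"
    moreover have "drop_coord i y = drop_coord i x"
      by (auto simp: drop_coord_def y_def vec_eq_iff axis_def)
    ultimately have "y $ i \<le> x $ i" using x max by auto
    with \<open>0 < k\<close> show False by (simp add: y_def axis_def)
  qed
  ultimately show "c \<in> (\<lambda>(x, y). drop_coord i x) ` {(x, y). x \<in> A \<and> y \<in> neighbors x \<omega> \<and> y \<notin> A}"
    using x by force
qed

text \<open>Splitting the coordinates into the blocks \<open>i\<close>, \<open>j\<close> and all
  others embeds \<open>A\<close> into a product of three factors. Each projection to two blocks
  ignores at least one coordinate, so it is no larger than a \<open>drop_coord\<close> image, which
  the boundary dominates; Loomis-Whitney combines the three bounds.\<close>

lemma isoperimetry:
  fixes A :: "(int ^ 'd::finite) set"
  assumes dim: "CARD('d) \<ge> 3" and \<omega>: "two_sided \<omega>" and A: "finite A" "A \<subseteq> points \<omega>"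
  shows "card A ^ 2 \<le> card {(x, y). x \<in> A \<and> y \<in> neighbors x \<omega> \<and> y \<notin> A} ^ 3"
proof -
  let ?B = "{(x, y). x \<in> A \<and> y \<in> neighbors x \<omega> \<and> y \<notin> A}"
  have "finite ?B"
    by (rule finite_subset[of _ "Sigma A (\<lambda>x. neighbors x \<omega>)"]) (use A in auto)
  have proj: "card (g ` A) \<le> card ?B" if g: "\<And>x y. drop_coord i x = drop_coord i y \<Longrightarrow> g x = g y"
    for g :: "int ^ 'd \<Rightarrow> 'z" and i
  proof -
    have drop: "drop_coord i (drop_coord i x) = drop_coord i x" for x
      by (simp add: drop_coord_def vec_eq_iff)
    have "g ` A = g ` drop_coord i ` A"
      unfolding image_image by (rule image_cong[OF refl]) (rule g, simp add: drop)
    then have "card (g ` A) \<le> card (drop_coord i ` A)" using A by (simp add: card_image_le)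
    also have "\<dots> \<le> card ((\<lambda>(x, y). drop_coord i x) ` ?B)"
      using drop_coord_subset_boundary[OF \<omega> A] \<open>finite ?B\<close> by (intro card_mono) auto
    also have "\<dots> \<le> card ?B" by (rule card_image_le[OF \<open>finite ?B\<close>])
    finally show ?thesis .
  qed
  obtain T :: "'d set" where "card T = 3" using obtain_subset_with_card_n[OF dim] by auto
  then obtain i j k :: 'd where ijk: "i \<noteq> j" "i \<noteq> k" "j \<noteq> k" by (auto simp: card_3_iff)
  define h where "h x = (x $ i, x $ j, drop_coord i (drop_coord j x))" for x :: "int ^ 'd"
  have "inj h"
  proof (rule injI)
    fix x y assume h: "h x = h y"
    have "x $ m = y $ m" for m
    proof -
      have "drop_coord i (drop_coord j x) $ m = drop_coord i (drop_coord j y) $ m"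
        using h by (simp add: h_def)
      then show ?thesis using h by (auto simp: h_def drop_coord_def split: if_splits)
    qed
    then show "x = y" by (simp add: vec_eq_iff)
  qed
  then have "card (h ` A) = card A" by (simp add: card_image inj_on_subset)
  have nth: "x $ m = y $ m" if "drop_coord n x = drop_coord n y" "m \<noteq> n" for x y :: "int ^ 'd" and m n
    using arg_cong[OF that(1), of "\<lambda>v. v $ m"] that(2) by (simp add: drop_coord_def)
  have comm: "drop_coord i (drop_coord j x) = drop_coord j (drop_coord i x)" for x :: "int ^ 'd"
    by (simp add: drop_coord_def vec_eq_iff)
  \<comment> \<open>The first two blocks do not see the coordinate \<open>k\<close>, which belongs
    to the third; this is where a third dimension enters.\<close>
  have "card ((\<lambda>(x, y, z). (x, y)) ` h ` A) \<le> card ?B"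
    unfolding image_image
  proof (rule proj[of k])
    fix x y :: "int ^ 'd" assume "drop_coord k x = drop_coord k y"
    from nth[OF this, of i] nth[OF this, of j] ijk
    show "(case h x of (x, y, z) \<Rightarrow> (x, y)) = (case h y of (x, y, z) \<Rightarrow> (x, y))"
      by (simp add: h_def)
  qed
  moreover have "card ((\<lambda>(x, y, z). (x, z)) ` h ` A) \<le> card ?B"
    unfolding image_image
  proof (rule proj[of j])
    fix x y :: "int ^ 'd" assume eq: "drop_coord j x = drop_coord j y"
    from nth[OF this, of i] ijk
    show "(case h x of (x, y, z) \<Rightarrow> (x, z)) = (case h y of (x, y, z) \<Rightarrow> (x, z))"
      by (simp add: h_def eq)
  qed
  moreover have "card ((\<lambda>(x, y, z). (y, z)) ` h ` A) \<le> card ?B"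
    unfolding image_image
  proof (rule proj[of i])
    fix x y :: "int ^ 'd" assume eq: "drop_coord i x = drop_coord i y"
    from nth[OF this, of j] ijk
    show "(case h x of (x, y, z) \<Rightarrow> (y, z)) = (case h y of (x, y, z) \<Rightarrow> (y, z))"
      by (simp add: h_def comm eq)
  qed
  ultimately have "card ((\<lambda>(x, y, z). (x, y)) ` h ` A) * card ((\<lambda>(x, y, z). (x, z)) ` h ` A)
    * card ((\<lambda>(x, y, z). (y, z)) ` h ` A) \<le> card ?B * card ?B * card ?B"
    by (intro mult_le_mono)
  then show ?thesis
    using loomis_whitney[of "h ` A"] A \<open>card (h ` A) = card A\<close> by (simp add: power3_eq_cube)
qed




section \<open>Recurrence of the environment and the quenched law\<close>

text \<open>\<open>F k\<close> says that \<open>x + k a\<close> is occupied and is the last occupied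
  site in direction \<open>e\<close>. These events are pairwise disjoint and, by invariance, equally
  likely, so each is null. Translating along \<open>a\<close> serves both \<open>e = a\<close> and
  \<open>e = - a\<close>.\<close>

lemma poincare_recurrence:
  fixes Q :: "('d::finite) config measure"
  assumes prob: "prob_space Q" and sets: "sets Q = sets config_space"
    and inv: "invariant_under Q (shift_by a)" and e: "e = a \<or> e = - a"
  shows "AE \<omega> in Q. \<omega> x \<longrightarrow> (\<exists>k>0. \<omega> (x + int k *s e))"
proof -
  interpret prob_space Q by (rule prob)
  have [simp]: "space Q = UNIV" using sets_eq_imp_space_eq[OF sets] by simp
  define F where "F k = {\<omega> \<in> space Q. \<omega> (x + int k *s a) \<and> (\<forall>j>0. \<not> \<omega> (x + int k *s a + int j *s e))}" for k
  have site[measurable]: "(\<lambda>\<omega>. \<omega> z) \<in> measurable Q (count_space UNIV)" for z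
    using measurable_site by (simp add: measurable_cong_sets[OF sets refl])
  have F[measurable]: "F k \<in> sets Q" for k unfolding F_def by measurable
  have T: "shift_by a \<in> measurable Q Q" and dT: "distr Q Q (shift_by a) = Q"
    using inv by (auto simp: invariant_under_def)
  have "measure Q (F (Suc k)) = measure Q (F k)" for k
  proof -
    have sh: "a + (x + int k *s a) = x + int (Suc k) *s a"
      "a + (x + int k *s a + v) = x + int (Suc k) *s a + v" for v
      by (simp_all add: vec_eq_iff algebra_simps)
    have "shift_by a -` F k \<inter> space Q = F (Suc k)"
      by (simp add: F_def shift_by_def vimage_def sh del: of_nat_Suc)
    then show ?thesis using measure_distr[OF T F[of k]] by (simp add: dT)
  qed
  then have const: "measure Q (F k) = measure Q (F 0)" for k by (induction k) auto
  have disj: "F k \<inter> F m = {}" if "k < m" for k m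
  proof -
    have "x + int k *s a + int (m - k) *s a = x + int m *s a"
      "x + int m *s a + int (m - k) *s (- a) = x + int k *s a"
      using that by (simp_all add: vec_eq_iff algebra_simps of_nat_diff)
    \<comment> \<open>For \<open>e = a\<close> the site indexed by \<open>m\<close> contradicts that
      the one indexed by \<open>k\<close> is last; for \<open>e = - a\<close> the roles are
      exchanged.\<close>
    then show ?thesis
      using e that unfolding F_def by (elim disjE) (auto dest!: spec[of _ "m - k"])
  qed
  then have "disjoint_family F"
    unfolding disjoint_family_on_def by (metis Int_commute linorder_neqE_nat)
  then have "summable (\<lambda>k. measure Q (F k))"
    using finite_measure_UNION[of F] F by (auto simp: sums_iff image_subset_iff)
  then have "measure Q (F 0) = 0" by (subst (asm) const) (simp add: summable_const_iff)
  then have "F 0 \<in> null_sets Q" by (simp add: null_sets_def emeasure_eq_measure)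
  then have "AE \<omega> in Q. \<omega> \<notin> F 0" by (rule AE_not_in)
  then show ?thesis by (rule AE_mp) (auto simp: F_def)
qed

lemma AE_two_sided:
  fixes Q :: "('d::finite) config measure"
  assumes "prob_space Q" "sets Q = sets config_space"
    and inv: "\<And>i. invariant_under Q (shift_by (axis i 1))"
  shows "AE \<omega> in Q. two_sided \<omega>"
proof -
  have "AE \<omega> in Q. \<omega> x \<longrightarrow> (\<exists>k>0. \<omega> (x + int k *s e))" if "e \<in> units" for x e
    using that poincare_recurrence[OF assms(1,2) inv] by (auto simp: units_def)
  then have "AE \<omega> in Q. \<forall>e\<in>units. \<forall>x. \<omega> x \<longrightarrow> (\<exists>k>0. \<omega> (x + int k *s e))"
    by (intro AE_finite_allI) (simp_all add: AE_all_countable)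
  then show ?thesis by (rule AE_mp) (auto simp: two_sided_def)
qed

text \<open>The Markov property at time \<open>n\<close>. The event \<open>X n = z\<close> splits
  into countably many cylinders, one for each history ending in \<open>z\<close>, and extending a
  cylinder by \<open>y\<close> multiplies its probability by the same factor.\<close>

lemma quenched_law_step:
  fixes y z :: "int ^ 'd::finite"
  shows "emeasure (quenched_law \<omega>) {X. X n = z \<and> X (Suc n) = y} =
    emeasure (quenched_law \<omega>) {X. X n = z} * ennreal (pmf (step \<omega> z) y)"
proof -
  \<comment> \<open>Histories are lists, covering times \<open>0\<close> to \<open>n\<close>,
    because lists over a countable type form a countable index set.\<close>
  define I where "I = {xs. length xs = Suc n \<and> xs ! n = z}"
  define C where "C xs = {X. \<forall>i\<le>n. X i = xs ! i}" for xs :: "(int ^ 'd) list"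
  define C' where "C' xs = {X. \<forall>i\<le>Suc n. X i = (xs @ [y]) ! i}" for xs :: "(int ^ 'd) list"
  have cyl: "{X. \<forall>i\<le>m. X i = x i} \<in> sets (quenched_law \<omega>)" for m and x :: "nat \<Rightarrow> int ^ 'd"
  proof -
    have "{X \<in> space path_space. \<forall>i\<le>m. X i = x i} \<in> sets path_space" by measurable
    then show ?thesis by simp
  qed
  have sets: "C xs \<in> sets (quenched_law \<omega>)" "C' xs \<in> sets (quenched_law \<omega>)" for xs
    unfolding C_def C'_def by (rule cyl)+
  have eq: "xs = map X [0..<Suc n]" if "xs \<in> I" "X \<in> C xs" for X xs
    using that by (intro nth_equalityI) (auto simp: I_def C_def less_Suc_eq_le simp del: upt_Suc)
  have C'_eq: "C' xs = C xs \<inter> {X. X (Suc n) = y}" if "xs \<in> I" for xs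
    using that by (auto simp: C_def C'_def I_def nth_append le_Suc_eq less_Suc_eq_le)
  have disj: "disjoint_family_on C I"
    unfolding disjoint_family_on_def using eq by blast
  then have disj': "disjoint_family_on C' I"
    using C'_eq unfolding disjoint_family_on_def by blast
  have Un: "{X. X n = z} = (\<Union>xs\<in>I. C xs)"
  proof (intro set_eqI iffI)
    fix X :: "nat \<Rightarrow> int ^ 'd" assume "X \<in> {X. X n = z}"
    then have "map X [0..<Suc n] \<in> I" "X \<in> C (map X [0..<Suc n])"
      by (auto simp: I_def C_def less_Suc_eq_le simp del: upt_Suc)
    then show "X \<in> (\<Union>xs\<in>I. C xs)" by blast
  qed (auto simp: I_def C_def)
  have Un': "{X. X n = z \<and> X (Suc n) = y} = (\<Union>xs\<in>I. C' xs)"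
    using Un C'_eq by auto
  have step: "emeasure (quenched_law \<omega>) (C' xs) =
      emeasure (quenched_law \<omega>) (C xs) * ennreal (pmf (step \<omega> z) y)" if "xs \<in> I" for xs
  proof -
    have "(\<Prod>i<n. ennreal (pmf (step \<omega> ((xs @ [y]) ! i)) ((xs @ [y]) ! Suc i))) =
        (\<Prod>i<n. ennreal (pmf (step \<omega> (xs ! i)) (xs ! Suc i)))"
      using that by (intro prod.cong) (auto simp: I_def nth_append)
    then show ?thesis
      using that unfolding C_def C'_def emeasure_quenched_law_cylinder
      by (simp add: I_def nth_append)
  qed
  have "emeasure (quenched_law \<omega>) (\<Union>xs\<in>I. C' xs) = (\<integral>\<^sup>+xs. emeasure (quenched_law \<omega>) (C' xs) \<partial>count_space I)"
    by (rule emeasure_UN_countable[OF sets(2) _ disj']) auto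
  also have "\<dots> = (\<integral>\<^sup>+xs. emeasure (quenched_law \<omega>) (C xs) * ennreal (pmf (step \<omega> z) y) \<partial>count_space I)"
    by (intro nn_integral_cong step) simp
  also have "\<dots> = (\<integral>\<^sup>+xs. emeasure (quenched_law \<omega>) (C xs) \<partial>count_space I) * ennreal (pmf (step \<omega> z) y)"
    by (rule nn_integral_multc) simp
  also have "(\<integral>\<^sup>+xs. emeasure (quenched_law \<omega>) (C xs) \<partial>count_space I) = emeasure (quenched_law \<omega>) (\<Union>xs\<in>I. C xs)"
    by (rule emeasure_UN_countable[OF sets(1) _ disj, symmetric]) auto
  finally show ?thesis unfolding Un Un' .
qed

text \<open>Occupied sites form a regular symmetric graph of degree \<open>2 * CARD('d)\<close>.
  Isoperimetry makes the return probabilities summable, and Borel-Cantelli excludes infinitely many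
  returns.\<close>

lemma AE_not_returns_infinitely_often:
  fixes \<omega> :: "'d::finite config"
  assumes dim: "CARD('d) \<ge> 3" and \<omega>: "two_sided \<omega>" "\<omega> 0"
  shows "AE X in quenched_law \<omega>. X \<notin> returns_infinitely_often"
proof -
  interpret regular_walk "\<lambda>v. neighbors v \<omega>" "points \<omega>" "2 * CARD('d)" 0
  proof
    fix x y assume x: "x \<in> points \<omega>"
    then have \<omega>x: "\<omega> x" by (simp add: points_def)
    show "neighbors x \<omega> \<subseteq> points \<omega>"
      using neighbors_iff[OF \<omega>(1) \<omega>x] by (auto simp: points_def)
    show "card (neighbors x \<omega>) = 2 * CARD('d)"
      using \<omega>(1) \<omega>x by (intro card_neighbors) (auto simp: two_sided_def)
    assume "y \<in> points \<omega>"
    then show "y \<in> neighbors x \<omega> \<longleftrightarrow> x \<in> neighbors y \<omega>"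
      using \<omega>x neighbors_sym[OF \<omega>(1)] by (auto simp: points_def)
  qed (simp_all add: points_def \<omega>)
  have sets1: "{X. X n = y} \<in> sets (quenched_law \<omega>)" for n and y :: "int ^ 'd"
  proof -
    have "{X \<in> space path_space. X n = y} \<in> sets path_space" by measurable
    then show ?thesis by simp
  qed
  \<comment> \<open>Identifies the marginals of the path measure with the abstract
    \<open>walk_law\<close>, by total probability over the position at time
    \<open>n\<close>.\<close>
  have law: "emeasure (quenched_law \<omega>) {X. X n = y} = ennreal (pmf (walk_law n) y)" for n y
  proof (induction n arbitrary: y)
    case 0
    show ?case using emeasure_quenched_law_cylinder[of \<omega> 0 "\<lambda>_. y"] by (simp add: indicator_def)
  next
    case (Suc n)
    have "{X. X n = z} \<inter> {X. X (Suc n) = y} \<in> sets (quenched_law \<omega>)" for z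
      by (intro sets.Int sets1)
    then have meas: "{X. X n = z \<and> X (Suc n) = y} \<in> sets (quenched_law \<omega>)" for z
      by (simp add: Collect_conj_eq)
    have "{X. X (Suc n) = y} = (\<Union>z. {X. X n = z \<and> X (Suc n) = y})" by auto
    also have "emeasure (quenched_law \<omega>) \<dots> =
        (\<integral>\<^sup>+z. emeasure (quenched_law \<omega>) {X. X n = z \<and> X (Suc n) = y} \<partial>count_space UNIV)"
      by (rule emeasure_UN_countable[OF meas]) (auto simp: disjoint_family_on_def)
    also have "\<dots> = (\<integral>\<^sup>+z. pmf (walk_law n) z * pmf (pmf_of_set (neighbors z \<omega>)) y \<partial>count_space UNIV)"
      unfolding quenched_law_step Suc step_def by (simp only: ennreal_mult[OF pmf_nonneg pmf_nonneg])
    also have "\<dots> = ennreal (pmf (walk_law (Suc n)) y)"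
      by (simp only: walk_law.simps ennreal_pmf_bind nn_integral_measure_pmf ennreal_mult[OF pmf_nonneg pmf_nonneg])
    finally show ?case .
  qed
  have "summable (\<lambda>n. pmf (walk_law n) 0)"
  proof (rule summable_return_probability)
    fix A assume "finite A" "A \<subseteq> points \<omega>"
    then show "card A ^ 2 \<le> card (edge_boundary A) ^ 3"
      using isoperimetry[OF dim \<omega>(1)] by (simp add: edge_boundary_def)
  qed
  moreover have "measure (quenched_law \<omega>) {X. X n = 0} = pmf (walk_law n) 0" for n
    using law[of n 0] by (simp add: measure_def)
  ultimately have "AE X in quenched_law \<omega>. eventually (\<lambda>n. X \<in> space (quenched_law \<omega>) - {X. X n = 0}) sequentially"
    using sets1 by (intro borel_cantelli_AE1) (auto simp: law)
  then show ?thesis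
    by (rule AE_mp) (auto simp: returns_infinitely_often_def eventually_sequentially infinite_nat_iff_unbounded_le)
qed

theorem theorem1p8:
  fixes Q :: "('d::finite) config measure"
  assumes dim: "CARD('d) \<ge> 3"
    and prob: "prob_space Q"
    and sets: "sets Q = sets config_space"
    and ergodic: "\<And>i. ergodic_under Q (shift_by (axis i 1))"
    and nonempty: "emeasure Q {\<omega>. points \<omega> = {}} < 1"
  shows "(AE X in annealed_law Q. X \<notin> returns_infinitely_often) \<and>
    (AE \<omega> in conditioned Q. emeasure (quenched_law \<omega>) returns_infinitely_often = 0)"
proof
  have "AE \<omega> in Q. two_sided \<omega>"
    using AE_two_sided[OF prob sets] ergodic by (simp add: ergodic_under_def)
  then have "AE \<omega> in Q. \<omega> \<in> occupied_origin \<longrightarrow> emeasure (quenched_law \<omega>) returns_infinitely_often = 0"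
  proof (rule AE_mp, intro AE_I2 impI)
    fix \<omega> :: "'d config" assume "two_sided \<omega>" "\<omega> \<in> occupied_origin"
    then have "AE X in quenched_law \<omega>. X \<notin> returns_infinitely_often"
      by (intro AE_not_returns_infinitely_often[OF dim]) (auto simp: occupied_origin_def)
    then show "emeasure (quenched_law \<omega>) returns_infinitely_often = 0"
      by (rule AE_iff_measurable[THEN iffD1, rotated 2])
        (auto simp: sets_eq_imp_space_eq[OF sets_quenched_law])
  qed
  then show quenched: "AE \<omega> in conditioned Q. emeasure (quenched_law \<omega>) returns_infinitely_often = 0"
    unfolding conditioned_def using sets by (intro AE_uniform_measureI) auto
  have sets_C: "sets (conditioned Q) = sets config_space" by (simp add: conditioned_def sets)
  have "sets (annealed_law Q) = sets path_space"
    unfolding annealed_law_def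
    by (rule sets_bind[of _ _ path_space])
       (use sets_eq_imp_space_eq[OF sets_C] in auto)
  \<comment> \<open>The annealed probability is the integral of the quenched ones, which vanish
    almost everywhere.\<close>
  moreover have "emeasure (annealed_law Q) returns_infinitely_often = 0"
    using quenched by (simp add: emeasure_annealed_law[OF sets] nn_integral_0_iff_AE
      cong: nn_integral_cong_AE)
  ultimately have "returns_infinitely_often \<in> null_sets (annealed_law Q)" by (auto simp: null_sets_def)
  then show "AE X in annealed_law Q. X \<notin> returns_infinitely_often" by (rule AE_not_in)
qed

end
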